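(* Let $m\ge 2$, $\rho\in(0,1)$, $\vec a=(a_1,\ldots,a_m)\in\mathbb{R}^m$, and suppose that the iterated function system $\mathcal{I}=\{f_j\}_{j=1}^m$, $f_j(x)=\rho x+a_j$, satisfies the strong separation condition. Let $\vec p=(p_1,\ldots,p_m)$ be a positive probability vector and let $\mu_\rho$ be the homogeneous self-similar measure on $\mathbb{R}$ associated with $\mathcal{I}$ and $\vec p$. Then for any $\varphi\in C^2(\mathbb{R})$ (real-valued) with $\varphi''>0$ on $\mathbb{R}$ and any $g\in C^1(\mathbb{R})$, there is a constant $\gamma>0$ such that $$\Big|\int \exp(2\pi i\xi\varphi(t))\,g(t)\,d\mu_\rho(t)\Big|=O(|\xi|^{-\gamma}),\qquad |\xi|\to\infty\ (\xi\in\mathbb{R}).$$ In particular, the Fourier transform of the image measure $\varphi\mu_\rho$ has power decay, i.e. $|\widehat{\varphi\mu_\rho}(\xi)|=O(|\xi|^{-\gamma})$ as $|\xi|\to\infty$ for some constant $\gamma>0$.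
   Context: For a Borel probability measure $\mu$ on $\mathbb{R}$, the Fourier transform is $\widehat\mu(\xi)=\int \exp(2\pi i\xi t)\,d\mu(t)$, $\xi\in\mathbb{R}$. For a measurable map $f:\mathbb{R}\to\mathbb{R}$, the image (push-forward) measure $f\mu$ is defined by $f\mu(A)=\mu(f^{-1}(A))$ for Borel $A\subset\mathbb{R}$. The attractor of $\mathcal{I}=\{f_j\}_{j=1}^m$ is the unique non-empty compact set $K\subset\mathbb{R}$ with $K=\bigcup_{j=1}^m f_j(K)$. The strong separation condition holds for $\mathcal{I}$ if the sets $f_1(K),\ldots,f_m(K)$ are pairwise disjoint. A positive probability vector is $\vec p=(p_1,\ldots,p_m)$ with $p_j>0$ for every $j$ and $\sum_{j=1}^m p_j=1$. The homogeneous self-similar measure $\mu_\rho$ associated with $\mathcal{I}$ and $\vec p$ is the unique Borel probability measure supported on $K$ with $\mu_\rho=\sum_{j=1}^m p_j\, f_j\mu_\rho$. *)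

theory Defs
  imports "HOL-Probability.Probability" "HOL-Library.Landau_Symbols"
begin

text \<open>
  An iterated function system of \<open>m\<close> maps is given by \<open>f 1, \<dots>, f m\<close>; values of \<open>f\<close> outside
  \<open>{1..m}\<close> are irrelevant.
\<close>

definition homogeneous_ifs :: "real \<Rightarrow> (nat \<Rightarrow> real) \<Rightarrow> nat \<Rightarrow> real \<Rightarrow> real" where
  "homogeneous_ifs \<rho> a j x = \<rho> * x + a j"

text \<open>
  Attractor and self-similar measure are predicates. For contractions, both exist and are unique
  by Hutchinson's theorem, so quantifying universally over the objects satisfying them speaks about
  \<^emph>\<open>the\<close> attractor and \<^emph>\<open>the\<close> self-similar measure.
\<close>

definition is_attractor :: "nat \<Rightarrow> (nat \<Rightarrow> real \<Rightarrow> real) \<Rightarrow> real set \<Rightarrow> bool" where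
  "is_attractor m f K \<longleftrightarrow> K \<noteq> {} \<and> compact K \<and> K = (\<Union>j\<in>{1..m}. f j ` K)"

definition strong_separation :: "nat \<Rightarrow> (nat \<Rightarrow> real \<Rightarrow> real) \<Rightarrow> real set \<Rightarrow> bool" where
  "strong_separation m f K \<longleftrightarrow> disjoint_family_on (\<lambda>j. f j ` K) {1..m}"

definition positive_probability_vector :: "nat \<Rightarrow> (nat \<Rightarrow> real) \<Rightarrow> bool" where
  "positive_probability_vector m p \<longleftrightarrow> (\<forall>j\<in>{1..m}. p j > 0) \<and> (\<Sum>j=1..m. p j) = 1"

definition is_self_similar_measure ::
  "nat \<Rightarrow> (nat \<Rightarrow> real \<Rightarrow> real) \<Rightarrow> (nat \<Rightarrow> real) \<Rightarrow> real set \<Rightarrow> real measure \<Rightarrow> bool" where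
  "is_self_similar_measure m f p K \<mu> \<longleftrightarrow>
     prob_space \<mu> \<and> sets \<mu> = sets borel \<and> measure \<mu> (- K) = 0 \<and>
     (\<forall>A\<in>sets borel. measure \<mu> A = (\<Sum>j=1..m. p j * measure (distr \<mu> borel (f j)) A))"

text \<open>
  The library's \<^const>\<open>char\<close> is normalised without the factor \<open>2\<pi>\<close>.
\<close>

definition fourier_transform :: "real measure \<Rightarrow> real \<Rightarrow> complex" where
  "fourier_transform \<mu> \<xi> = (\<integral>t. exp (2 * of_real pi * \<i> * of_real \<xi> * of_real t) \<partial>\<mu>)"

end

theory Submission
  imports Defs
begin

text \<open>
  Write \<open>P u = \<Sum>j. p\<^sub>j e\<^bsup>i u a\<^sub>j\<^esup>\<close> for the characteristic function of one random digit
  (\<open>digit_char\<close>). Self-similarity reads \<open>\<mu>^ u = P u \<cdot> \<mu>^ (\<rho> u)\<close>, so \<open>|\<mu>^ u|\<close> is at most any finite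
  product of factors \<open>|P (\<rho>\<^sup>i u)|\<close>. At a single frequency this product need not be small; but the
  curvature of \<open>\<phi>\<close> replaces one frequency by a \<open>\<mu>\<close>-average over many, and the average is small.

  \<^emph>\<open>Linearisation\<close> (\<open>oscillatory_integral_le_mean_digit_char_product\<close>). Cut \<open>\<mu>\<close> into cylinders of
  generation \<open>n\<close>. On the cylinder around a point \<open>y\<close>, replace \<open>\<phi>\<close> by its tangent at \<open>y\<close> and \<open>g\<close> by
  its value at \<open>y\<close>; the integral over the cylinder becomes \<open>\<mu>^ (\<tau> \<rho>\<^sup>n \<phi>' y)\<close> up to a bounded factor,
  with an error of order \<open>|\<tau>| \<rho>\<^bsup>2n\<^esup> + \<rho>\<^sup>n\<close>. Since \<open>y\<close> may be any point of the cylinder, averaging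
  over \<open>y\<close> bounds the whole integral by the \<open>\<mu>\<close>-mean of \<open>|\<mu>^ (\<tau> \<rho>\<^sup>n \<phi>' y)|\<close>.

  \<^emph>\<open>Decay of the mean\<close> (\<open>mean_digit_char_product_decay\<close>). Order the factors from the lowest
  frequency upwards: they are \<open>|P (S \<rho>\<^bsup>-i\<^esup> \<phi>' y)|\<close>, with \<open>|S|\<close> of order one. Fix the first \<open>i\<close> digits
  of \<open>y\<close>. Because \<open>\<phi>'\<close> is bi-Lipschitz and the first two pieces of \<open>K\<close> are a positive distance
  apart, switching the next digit between \<open>1\<close> and \<open>2\<close> moves \<open>(a\<^sub>2 - a\<^sub>1) S \<rho>\<^bsup>-i\<^esup> \<phi>' y\<close> by an amount
  which is bounded below and at most \<open>\<pi>\<close>. Both positions cannot be close to \<open>2\<pi>\<int>\<close>, so for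
  one of the two digits the factor is at most \<open>1 - \<delta>\<close>, whatever digits follow
  (\<open>digit_char_small_at_one_of_two\<close>). Every further factor thus multiplies the mean by at most
  \<open>1 - \<delta> min (p\<^sub>1, p\<^sub>2)\<close>.

  \<^emph>\<open>Choice of scales\<close> (\<open>oscillatory_integral_power_decay\<close>). With \<open>|\<tau>|\<close> of order \<open>\<rho>\<^bsup>-3k\<^esup>\<close> and \<open>n = 2k\<close>, the
  error is of order \<open>\<rho>\<^sup>k\<close> while \<open>k + 1\<close> factors remain, so both terms are exponentially small in \<open>k\<close>,
  that is, a negative power of \<open>|\<tau>|\<close>.
\<close>

section \<open>Elementary estimates\<close>

lemma cmod_cis_minus_1_sq: "(cmod (cis x - 1))\<^sup>2 = 2 - 2 * cos x"
  using sin_cos_squared_add[of x] unfolding cmod_power2 by (simp add: power2_eq_square algebra_simps)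

lemma cmod_weighted_cis_sq:
  "(cmod (p *\<^sub>R cis s + q *\<^sub>R cis t))\<^sup>2 = (p + q)\<^sup>2 - p * q * (cmod (cis (t - s) - 1))\<^sup>2"
proof -
  have "(cmod (p *\<^sub>R cis s + q *\<^sub>R cis t))\<^sup>2
      = p\<^sup>2 * ((sin s)\<^sup>2 + (cos s)\<^sup>2) + q\<^sup>2 * ((sin t)\<^sup>2 + (cos t)\<^sup>2) + 2 * p * q * cos (t - s)"
    unfolding cmod_power2
    by (simp add: cos_diff power2_eq_square algebra_simps del: sin_cos_squared_add sin_cos_squared_add2 sin_cos_squared_add3)
  then show ?thesis
    unfolding cmod_cis_minus_1_sq sin_cos_squared_add by (simp add: power2_eq_square algebra_simps)
qed

lemma cmod_cis_diff_le: "cmod (cis s - cis t) \<le> \<bar>s - t\<bar>"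
proof -
  have "cis s - cis t = cis t * (cis (s - t) - 1)"
    by (simp add: right_diff_distrib cis_mult)
  then have "cmod (cis s - cis t) = cmod (cis (s - t) - 1)"
    by (simp add: norm_mult)
  also have "\<dots> \<le> \<bar>s - t\<bar>"
  proof (rule power2_le_imp_le)
    have "2 * ((s - t) / 2) = s - t" by simp
    then have "(cmod (cis (s - t) - 1))\<^sup>2 = 4 * \<bar>sin ((s - t) / 2)\<bar>\<^sup>2"
      unfolding cmod_cis_minus_1_sq using cos_double_sin[of "(s - t) / 2"] by (simp only:) simp
    also have "\<dots> \<le> 4 * \<bar>(s - t) / 2\<bar>\<^sup>2"
      by (intro mult_left_mono power_mono abs_sin_x_le_abs_x) auto
    also have "\<dots> = \<bar>s - t\<bar>\<^sup>2"
      by (simp add: power_divide)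
    finally show "(cmod (cis (s - t) - 1))\<^sup>2 \<le> \<bar>s - t\<bar>\<^sup>2" .
  qed simp
  finally show ?thesis .
qed

text \<open>
  Frequencies are compared along the scales \<open>q\<^sup>k\<close>: the first power that brings \<open>t\<close> below \<open>s\<close> does not
  overshoot by more than one step.
\<close>

lemma geometric_rescaling:
  fixes q s t :: real
  assumes "0 < q" "q < 1" "0 < s" "s \<le> t"
  obtains k where "q * s \<le> q ^ k * t" "q ^ k * t \<le> s"
proof -
  have "0 < t" using assms by simp
  obtain n where "q ^ n < s / t"
    using real_arch_pow_inv[of "s / t" q] assms by auto
  then have ex: "q ^ n * t \<le> s"
    using \<open>0 < t\<close> by (simp add: field_simps)
  define k where "k = (LEAST k. q ^ k * t \<le> s)"
  have le: "q ^ k * t \<le> s"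
    unfolding k_def using ex by (rule LeastI)
  show ?thesis
  proof (rule that[OF _ le], cases k)
    case 0
    have "q * s \<le> 1 * s"
      using assms by (intro mult_right_mono) auto
    then show "q * s \<le> q ^ k * t" using 0 \<open>s \<le> t\<close> by simp
  next
    case (Suc j)
    then have "s < q ^ j * t"
      using not_less_Least[of j "\<lambda>k. q ^ k * t \<le> s"] by (simp add: k_def)
    then show "q * s \<le> q ^ k * t"
      using Suc assms by (simp add: mult.assoc)
  qed
qed

section \<open>Integration against a self-similar measure\<close>

locale homogeneous_self_similar_measure =
  fixes m :: nat and \<rho> :: real and a p :: "nat \<Rightarrow> real"
    and K :: "real set" and \<mu> :: "real measure"
  assumes m_ge_2: "m \<ge> 2" and rho_pos: "0 < \<rho>" and rho_less_1: "\<rho> < 1"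
    and attractor: "is_attractor m (homogeneous_ifs \<rho> a) K"
    and separation: "strong_separation m (homogeneous_ifs \<rho> a) K"
    and probability_vector: "positive_probability_vector m p"
    and self_similar: "is_self_similar_measure m (homogeneous_ifs \<rho> a) p K \<mu>"
begin

sublocale prob_space \<mu>
  using self_similar by (simp add: is_self_similar_measure_def)

lemma sets_mu [measurable_cong]: "sets \<mu> = sets borel"
  using self_similar by (simp add: is_self_similar_measure_def)

lemma space_mu [simp]: "space \<mu> = UNIV"
  using sets_eq_imp_space_eq[OF sets_mu] by simp

lemma prob_UNIV [simp]: "measure \<mu> UNIV = 1"
  using prob_space by simp

lemma compact_K: "compact K" and K_nonempty: "K \<noteq> {}"
  using attractor by (auto simp: is_attractor_def)

lemma map_in_K: "x \<in> K \<Longrightarrow> j \<in> {1..m} \<Longrightarrow> \<rho> * x + a j \<in> K"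
  using attractor unfolding is_attractor_def homogeneous_ifs_def by blast

lemma p_pos: "j \<in> {1..m} \<Longrightarrow> 0 < p j" and p_nonneg: "j \<in> {1..m} \<Longrightarrow> 0 \<le> p j"
  and sum_p: "(\<Sum>j=1..m. p j) = 1"
  using probability_vector by (auto simp: positive_probability_vector_def less_imp_le)

lemma AE_in_K: "AE x in \<mu>. x \<in> K"
proof -
  have K: "K \<in> sets borel"
    using compact_K by (simp add: borel_closed compact_imp_closed)
  have "measure \<mu> (- K) = 0"
    using self_similar by (simp add: is_self_similar_measure_def)
  then have "emeasure \<mu> (- K) = 0"
    by (simp add: emeasure_eq_measure)
  then have "- K \<in> null_sets \<mu>"
    using K by (auto simp: null_sets_def sets_mu)
  then have "AE x in \<mu>. x \<notin> - K" by (rule AE_not_in)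
  then show ?thesis by simp
qed

lemma measurable_continuous:
  fixes F :: "real \<Rightarrow> 'b::{banach, second_countable_topology}"
  assumes "continuous_on UNIV F"
  shows "F \<in> borel_measurable \<mu>"
  using borel_measurable_continuous_onI[OF assms] by (simp cong: measurable_cong_sets add: sets_mu)

lemma integrable_continuous:
  fixes F :: "real \<Rightarrow> 'b::{banach, second_countable_topology}"
  assumes "continuous_on UNIV F"
  shows "integrable \<mu> F"
proof -
  have "compact (F ` K)"
    using assms compact_K by (meson compact_continuous_image continuous_on_subset subset_UNIV)
  then obtain B where B: "\<And>x. x \<in> K \<Longrightarrow> norm (F x) \<le> B"
    by (meson bounded_iff compact_imp_bounded imageI)
  then have "AE x in \<mu>. norm (F x) \<le> B"
    using AE_in_K by auto
  then show ?thesis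
    by (rule integrable_const_bound) (rule measurable_continuous[OF assms])
qed

lemma integral_mono_K:
  fixes F H :: "real \<Rightarrow> real"
  assumes "continuous_on UNIV F" "continuous_on UNIV H" "\<And>x. x \<in> K \<Longrightarrow> F x \<le> H x"
  shows "(\<integral>x. F x \<partial>\<mu>) \<le> (\<integral>x. H x \<partial>\<mu>)"
  using AE_in_K assms by (intro integral_mono_AE integrable_continuous) auto

text \<open>
  Invariance is assumed for measures of sets. It says that \<open>\<mu>\<close> is the law of \<open>\<rho> x + a\<^sub>j\<close> for
  independent \<open>j\<close> and \<open>x\<close> distributed by \<open>p\<close> and \<open>\<mu>\<close>, and in this form Fubini's theorem
  carries it over to all Bochner integrals.
\<close>

lemma integral_self_similar:
  fixes F :: "real \<Rightarrow> 'b::{banach, second_countable_topology}"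
  assumes F: "integrable \<mu> F"
  shows "(\<integral>x. F x \<partial>\<mu>) = (\<Sum>j=1..m. p j *\<^sub>R (\<integral>x. F (\<rho> * x + a j) \<partial>\<mu>))"
proof -
  define q where "q j = (if j \<in> {1..m} then p j else 0)" for j
  define D where "D = embed_pmf q"
  have q0: "0 \<le> q j" for j using p_nonneg by (simp add: q_def)
  have "(\<integral>\<^sup>+ j. ennreal (q j) \<partial>count_space UNIV) = (\<Sum>j=1..m. ennreal (p j))"
    by (subst nn_integral_count_space'[of "{1..m}"]) (auto simp: q_def)
  also have "\<dots> = 1"
    using sum_p p_nonneg by (subst sum_ennreal) auto
  finally have pmf_D: "pmf D j = q j" for j
    unfolding D_def by (rule pmf_embed_pmf[OF q0])
  have integral_D: "(\<integral>j. h j \<partial>measure_pmf D) = (\<Sum>j=1..m. p j *\<^sub>R h j)"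
    for h :: "nat \<Rightarrow> 'c::{banach, second_countable_topology}"
    by (subst integral_measure_pmf[of "{1..m}"]) (auto simp: set_pmf_iff pmf_D q_def split: if_splits)
  define T where "T = (\<lambda>(j, x). \<rho> * x + a j)"
  interpret DM: pair_prob_space "measure_pmf D" \<mu> ..
  have [measurable]: "T \<in> measurable (measure_pmf D \<Otimes>\<^sub>M \<mu>) borel"
    unfolding T_def by measurable
  have fubini: "(\<integral>z. h (T z) \<partial>(measure_pmf D \<Otimes>\<^sub>M \<mu>)) = (\<Sum>j=1..m. p j *\<^sub>R (\<integral>x. h (\<rho> * x + a j) \<partial>\<mu>))"
    if "integrable (measure_pmf D \<Otimes>\<^sub>M \<mu>) (\<lambda>z. h (T z))"
    for h :: "real \<Rightarrow> 'c::{banach, second_countable_topology}"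
    using DM.integral_fst'[OF that] by (simp add: integral_D T_def)
  have eq: "distr (measure_pmf D \<Otimes>\<^sub>M \<mu>) borel T = \<mu>"
  proof (rule measure_eqI)
    fix A assume "A \<in> sets (distr (measure_pmf D \<Otimes>\<^sub>M \<mu>) borel T)"
    then have A [measurable]: "A \<in> sets borel" by simp
    have "measure (distr (measure_pmf D \<Otimes>\<^sub>M \<mu>) borel T) A
        = (\<integral>z. indicator A (T z) \<partial>(measure_pmf D \<Otimes>\<^sub>M \<mu>))"
      by (subst integral_distr[of T _ borel "indicator A", symmetric]) auto
    also have "\<dots> = (\<Sum>j=1..m. p j *\<^sub>R (\<integral>x. indicator A (\<rho> * x + a j) \<partial>\<mu>))"
      by (rule fubini) (auto intro!: DM.integrable_const_bound[where B=1])
    also have "\<dots> = (\<Sum>j=1..m. p j * measure (distr \<mu> borel (homogeneous_ifs \<rho> a j)) A)"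
    proof (rule sum.cong[OF refl])
      fix j
      have [measurable]: "homogeneous_ifs \<rho> a j \<in> borel_measurable borel"
        unfolding homogeneous_ifs_def by measurable
      have "(\<integral>x. indicat_real A (\<rho> * x + a j) \<partial>\<mu>) = (\<integral>x. indicator A x \<partial>distr \<mu> borel (homogeneous_ifs \<rho> a j))"
        by (subst integral_distr) (auto simp: homogeneous_ifs_def)
      then show "p j *\<^sub>R (\<integral>x. indicator A (\<rho> * x + a j) \<partial>\<mu>)
          = p j * measure (distr \<mu> borel (homogeneous_ifs \<rho> a j)) A"
        by simp
    qed
    also have "\<dots> = measure \<mu> A"
      using self_similar A by (simp add: is_self_similar_measure_def)
    finally show "emeasure (distr (measure_pmf D \<Otimes>\<^sub>M \<mu>) borel T) A = emeasure \<mu> A"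
      using DM.prob_space_distr[of T borel] by (simp add: emeasure_eq_measure
        finite_measure.emeasure_eq_measure prob_space.finite_measure)
  qed (simp add: sets_mu)
  have [measurable]: "F \<in> borel_measurable borel"
    using borel_measurable_integrable[OF F] by simp
  have "integrable (measure_pmf D \<Otimes>\<^sub>M \<mu>) (\<lambda>z. F (T z))"
    using F by (subst (asm) eq[symmetric]) (simp add: integrable_distr_eq)
  moreover have "(\<integral>x. F x \<partial>\<mu>) = (\<integral>z. F (T z) \<partial>(measure_pmf D \<Otimes>\<^sub>M \<mu>))"
    by (subst eq[symmetric], subst integral_distr) auto
  ultimately show ?thesis
    using fubini[of F] by simp
qed

section \<open>The characteristic function of one digit\<close>

lemma separation_gap:
  obtains d where "0 < d"
    "\<And>x y. x \<in> K \<Longrightarrow> y \<in> K \<Longrightarrow> d \<le> \<bar>(\<rho> * x + a 1) - (\<rho> * y + a 2)\<bar>"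
proof -
  let ?f = "\<lambda>j x. \<rho> * x + a j"
  have "?f 1 ` K \<inter> ?f 2 ` K = {}"
    using separation m_ge_2
    by (auto simp: strong_separation_def disjoint_family_on_def homogeneous_ifs_def)
  moreover have "compact (?f j ` K)" for j
    by (intro compact_continuous_image compact_K continuous_intros)
  ultimately obtain d where "0 < d" "\<forall>x\<in>?f 1 ` K. \<forall>y\<in>?f 2 ` K. d \<le> dist x y"
    using separate_compact_closed[of "?f 1 ` K" "?f 2 ` K"] compact_imp_closed by blast
  then show ?thesis
    by (intro that[of d]) (auto simp: dist_real_def)
qed

lemma translations_differ: "a 1 \<noteq> a 2"
proof
  assume "a 1 = a 2"
  obtain x where "x \<in> K" using K_nonempty by blast
  obtain d where "0 < d" "d \<le> \<bar>(\<rho> * x + a 1) - (\<rho> * x + a 2)\<bar>"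
    using separation_gap \<open>x \<in> K\<close> by metis
  with \<open>a 1 = a 2\<close> show False by simp
qed

definition digit_char :: "real \<Rightarrow> complex" where
  "digit_char u = (\<Sum>j=1..m. p j *\<^sub>R cis (u * a j))"

lemma cmod_digit_char_le:
  "cmod (digit_char u) \<le> 1 - (p 1 + p 2) + cmod (p 1 *\<^sub>R cis (u * a 1) + p 2 *\<^sub>R cis (u * a 2))"
proof -
  have split: "sum h {1..m} = h 1 + h 2 + sum h {3..m}" for h :: "nat \<Rightarrow> 'c::comm_monoid_add"
  proof -
    have "{1..m} = insert 1 (insert 2 {3..m})" using m_ge_2 by auto
    then show ?thesis by (simp add: add.assoc)
  qed
  have "cmod (\<Sum>j=3..m. p j *\<^sub>R cis (u * a j)) \<le> (\<Sum>j=3..m. cmod (p j *\<^sub>R cis (u * a j)))"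
    by (rule norm_sum)
  also have "\<dots> = (\<Sum>j=3..m. p j)"
    using p_nonneg by (intro sum.cong) auto
  also have "\<dots> = 1 - (p 1 + p 2)"
    using sum_p split[of p] by simp
  finally have "cmod (\<Sum>j=3..m. p j *\<^sub>R cis (u * a j)) \<le> 1 - (p 1 + p 2)" .
  moreover have "cmod (digit_char u) \<le> cmod (p 1 *\<^sub>R cis (u * a 1) + p 2 *\<^sub>R cis (u * a 2))
      + cmod (\<Sum>j=3..m. p j *\<^sub>R cis (u * a j))"
    unfolding digit_char_def split by (rule norm_triangle_ineq)
  ultimately show ?thesis by simp
qed

lemma first_two_weights: "0 < p 1" "0 < p 2" "p 1 + p 2 \<le> 1"
proof -
  show "0 < p 1" "0 < p 2" using m_ge_2 by (auto intro!: p_pos)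
  have "(\<Sum>j\<in>{1,2}. p j) \<le> (\<Sum>j=1..m. p j)"
    using m_ge_2 by (intro sum_mono2) (auto intro!: p_nonneg)
  then show "p 1 + p 2 \<le> 1" using sum_p by simp
qed

lemma cmod_digit_char_le_1: "cmod (digit_char u) \<le> 1"
proof -
  have "cmod (digit_char u) \<le> (\<Sum>j=1..m. cmod (p j *\<^sub>R cis (u * a j)))"
    unfolding digit_char_def by (rule norm_sum)
  also have "\<dots> = 1"
    using sum_p p_nonneg by (simp add: abs_of_nonneg)
  finally show ?thesis .
qed

lemma continuous_on_digit_char [continuous_intros]:
  "continuous_on S h \<Longrightarrow> continuous_on S (\<lambda>x. digit_char (h x))"
  unfolding digit_char_def by (intro continuous_intros)

text \<open>
  \<open>|P u|\<close> is close to \<open>1\<close> only if the first two terms of \<open>P u\<close> are nearly aligned, that is, if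
  \<open>(a\<^sub>2 - a\<^sub>1) u\<close> is close to \<open>2\<pi>\<int>\<close>. If the closeness is sharp
  enough in terms of \<open>c\<close>, two such numbers cannot differ by an amount between \<open>c\<close> and \<open>\<pi>\<close>.
\<close>

lemma digit_char_small_at_one_of_two:
  assumes "0 < c"
  obtains \<delta> where "0 < \<delta>" "\<delta> \<le> 1"
    "\<And>u v. c \<le> \<bar>(a 2 - a 1) * (u - v)\<bar> \<Longrightarrow> \<bar>(a 2 - a 1) * (u - v)\<bar> \<le> pi \<Longrightarrow>
       cmod (digit_char u) \<le> 1 - \<delta> \<or> cmod (digit_char v) \<le> 1 - \<delta>"
proof (cases "c \<le> pi")
  case False
  then show ?thesis by (intro that[of 1]) auto
next
  case True
  \<comment> \<open>\<open>2 \<eta>\<close> is the chord of an arc of length \<open>c\<close> on the unit circle; one of two points at least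
    that far apart is at distance \<open>\<eta>\<close> or more from \<open>1\<close>.\<close>
  define \<eta> where "\<eta> = sqrt (2 - 2 * cos c) / 2"
  define w where "w = sqrt ((p 1 + p 2)\<^sup>2 - p 1 * p 2 * \<eta>\<^sup>2)"
  define \<delta> where "\<delta> = p 1 + p 2 - w"
  have "cos c < cos 0"
    using \<open>0 < c\<close> True by (intro cos_monotone_0_pi) auto
  then have eta: "0 < \<eta>" "\<eta>\<^sup>2 = (2 - 2 * cos c) / 4"
    by (simp_all add: \<eta>_def power_divide)
  have "p 1 * p 2 * \<eta>\<^sup>2 \<le> p 1 * p 2 * 1"
  proof (rule mult_left_mono)
    have "2 - 2 * cos c \<le> 2 - 2 * (- 1)"
      by (intro diff_left_mono mult_left_mono) auto
    then show "\<eta>\<^sup>2 \<le> 1" unfolding eta(2) by simp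
  qed (use first_two_weights in simp)
  also have "\<dots> \<le> (p 1 + p 2)\<^sup>2"
    using first_two_weights by (simp add: power2_eq_square algebra_simps)
  finally have w0: "0 \<le> w" by (simp add: w_def)
  have "w < sqrt ((p 1 + p 2)\<^sup>2)"
    unfolding w_def using first_two_weights eta(1) by (intro real_sqrt_less_mono) simp
  then have "0 < \<delta>" using first_two_weights by (simp add: \<delta>_def)
  have small: "cmod (digit_char u) \<le> 1 - \<delta>" if "\<eta> \<le> cmod (cis ((a 2 - a 1) * u) - 1)" for u
  proof -
    have "(cmod (p 1 *\<^sub>R cis (u * a 1) + p 2 *\<^sub>R cis (u * a 2)))\<^sup>2
        = (p 1 + p 2)\<^sup>2 - p 1 * p 2 * (cmod (cis ((a 2 - a 1) * u) - 1))\<^sup>2"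
      unfolding cmod_weighted_cis_sq by (simp add: algebra_simps)
    also have "\<dots> \<le> (p 1 + p 2)\<^sup>2 - p 1 * p 2 * \<eta>\<^sup>2"
      using first_two_weights eta(1) that by (intro diff_left_mono mult_left_mono power_mono) auto
    finally have "cmod (p 1 *\<^sub>R cis (u * a 1) + p 2 *\<^sub>R cis (u * a 2)) \<le> w"
      unfolding w_def by (rule real_le_rsqrt)
    then show ?thesis
      using cmod_digit_char_le[of u] by (simp add: \<delta>_def)
  qed
  show ?thesis
  proof (rule that[of \<delta>])
    show "\<delta> \<le> 1" using first_two_weights w0 by (simp add: \<delta>_def)
    fix u v
    define s t where "s = (a 2 - a 1) * u" and "t = (a 2 - a 1) * v"
    assume "c \<le> \<bar>(a 2 - a 1) * (u - v)\<bar>" "\<bar>(a 2 - a 1) * (u - v)\<bar> \<le> pi"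
    then have "c \<le> \<bar>s - t\<bar>" "\<bar>s - t\<bar> \<le> pi"
      by (simp_all add: s_def t_def right_diff_distrib)
    then have "cos \<bar>s - t\<bar> \<le> cos c"
      using \<open>0 < c\<close> by (intro cos_monotone_0_pi_le) auto
    then have "(2 * \<eta>)\<^sup>2 \<le> (cmod (cis (s - t) - 1))\<^sup>2"
      unfolding cmod_cis_minus_1_sq power_mult_distrib eta(2) by simp
    then have "2 * \<eta> \<le> cmod (cis (s - t) - 1)"
      by (rule power2_le_imp_le) simp
    also have "\<dots> = cmod (cis t * (cis (s - t) - 1))"
      by (simp add: norm_mult)
    also have "cis t * (cis (s - t) - 1) = (cis s - 1) - (cis t - 1)"
      by (simp add: right_diff_distrib cis_mult)
    also have "cmod \<dots> \<le> cmod (cis s - 1) + cmod (cis t - 1)"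
      by (rule norm_triangle_ineq4)
    finally have "\<eta> \<le> cmod (cis s - 1) \<or> \<eta> \<le> cmod (cis t - 1)" by linarith
    then show "cmod (digit_char u) \<le> 1 - \<delta> \<or> cmod (digit_char v) \<le> 1 - \<delta>"
      using small unfolding s_def t_def by blast
  qed (fact \<open>0 < \<delta>\<close>)
qed

text \<open>
  This iterates \<open>\<mu>^ u = P u \<cdot> \<mu>^ (\<rho> u)\<close> and bounds the last factor \<open>\<mu>^ (\<rho>\<^sup>J u)\<close> by \<open>1\<close>.
\<close>

lemma cmod_char_le_digit_char_product: "cmod (char \<mu> u) \<le> (\<Prod>i<J. cmod (digit_char (\<rho> ^ i * u)))"
proof (induction J arbitrary: u)
  case 0
  have "cmod (char \<mu> u) \<le> (\<integral>x. norm (iexp (u * x)) \<partial>\<mu>)"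
    unfolding char_def by (rule integral_norm_bound)
  also have "\<dots> = 1"
    by (simp del: of_real_mult add: prob_space)
  finally show ?case by simp
next
  case (Suc J)
  have "char \<mu> u = (\<Sum>j=1..m. p j *\<^sub>R (\<integral>x. iexp (u * (\<rho> * x + a j)) \<partial>\<mu>))"
    unfolding char_def by (intro integral_self_similar integrable_continuous continuous_intros)
  also have "\<dots> = (\<Sum>j=1..m. p j *\<^sub>R (cis (u * a j) * char \<mu> (\<rho> * u)))"
  proof (rule sum.cong[OF refl])
    fix j
    have "iexp (u * (\<rho> * x + a j)) = cis (u * a j) * iexp (\<rho> * u * x)" for x
      by (simp add: cis_conv_exp exp_add[symmetric] algebra_simps)
    then show "p j *\<^sub>R (\<integral>x. iexp (u * (\<rho> * x + a j)) \<partial>\<mu>) = p j *\<^sub>R (cis (u * a j) * char \<mu> (\<rho> * u))"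
      by (simp only: char_def integral_mult_right_zero)
  qed
  also have "\<dots> = digit_char u * char \<mu> (\<rho> * u)"
    by (simp add: digit_char_def sum_distrib_right)
  finally have "cmod (char \<mu> u) = cmod (digit_char u) * cmod (char \<mu> (\<rho> * u))"
    by (simp add: norm_mult)
  also have "\<dots> \<le> cmod (digit_char u) * (\<Prod>i<J. cmod (digit_char (\<rho> ^ i * (\<rho> * u))))"
    by (intro mult_left_mono Suc.IH) simp
  also have "\<dots> = (\<Prod>i<Suc J. cmod (digit_char (\<rho> ^ i * u)))"
    unfolding prod.lessThan_Suc_shift by (simp add: mult.assoc mult.left_commute)
  finally show ?case .
qed

section \<open>Exponential decay of the averaged product\<close>

text \<open>
  This is the core of the proof. The product is peeled off from the lowest frequency, one digit of \<open>y\<close>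
  at a time, in parallel with \<open>\<mu> = \<Sum>j. p\<^sub>j f\<^sub>j\<mu>\<close>. The upper Lipschitz bound serves to choose \<open>S\<^sub>1\<close> so
  small that changing one digit moves the phase by at most \<open>\<pi>\<close>; the lower one, together with the
  gap between the pieces of \<open>K\<close> and the bound \<open>S\<^sub>0\<close>, keeps this motion away from zero. The rate
  \<open>\<kappa>\<close> depends on \<open>S\<^sub>0\<close>, which is why \<open>S\<^sub>1\<close> is chosen first.
\<close>

lemma mean_digit_char_product_decay:
  fixes G :: "real \<Rightarrow> real"
  assumes G: "continuous_on UNIV G" and "0 < c"
    and lower: "\<And>x y. x \<in> K \<Longrightarrow> y \<in> K \<Longrightarrow> c * \<bar>x - y\<bar> \<le> \<bar>G x - G y\<bar>"
    and upper: "\<And>x y. x \<in> K \<Longrightarrow> y \<in> K \<Longrightarrow> \<bar>G x - G y\<bar> \<le> C * \<bar>x - y\<bar>"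
  obtains S\<^sub>1 where "0 < S\<^sub>1"
    "\<And>S\<^sub>0. 0 < S\<^sub>0 \<Longrightarrow> \<exists>\<kappa>>0. \<kappa> < 1 \<and> (\<forall>S J. S\<^sub>0 \<le> \<bar>S\<bar> \<longrightarrow> \<bar>S\<bar> \<le> S\<^sub>1 \<longrightarrow>
       (\<integral>y. (\<Prod>i<J. cmod (digit_char (S / \<rho> ^ i * G y))) \<partial>\<mu>) \<le> \<kappa> ^ J)"
proof -
  define \<beta> where "\<beta> = \<bar>a 2 - a 1\<bar>"
  have "0 < \<beta>" using translations_differ by (simp add: \<beta>_def)
  obtain R where R: "\<And>x. x \<in> K \<Longrightarrow> \<bar>x\<bar> \<le> R"
    using compact_imp_bounded[OF compact_K] by (auto simp: bounded_iff)
  have R_diff: "\<bar>x - y\<bar> \<le> 2 * \<bar>R\<bar>" if "x \<in> K" "y \<in> K" for x y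
    using R[OF that(1)] R[OF that(2)] by linarith
  obtain d where "0 < d" and d:
    "\<And>x y. x \<in> K \<Longrightarrow> y \<in> K \<Longrightarrow> d \<le> \<bar>(\<rho> * x + a 1) - (\<rho> * y + a 2)\<bar>"
    by (rule separation_gap) blast
  \<comment> \<open>\<open>E - 1\<close> bounds \<open>\<bar>(a\<^sub>2 - a\<^sub>1) (G x - G y)\<bar>\<close> on \<open>K\<close>; the summand \<open>1\<close> keeps \<open>E\<close> positive.\<close>
  define E where "E = \<beta> * (\<bar>C\<bar> * (2 * \<bar>R\<bar>)) + 1"
  have "0 < E" using \<open>0 < \<beta>\<close> by (simp add: E_def add_nonneg_pos)
  define S\<^sub>1 where "S\<^sub>1 = pi / E"
  show ?thesis
  proof (rule that[of S\<^sub>1])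
    show "0 < S\<^sub>1" using \<open>0 < E\<close> by (simp add: S\<^sub>1_def)
    fix S\<^sub>0 :: real assume "0 < S\<^sub>0"
    define c' where "c' = \<beta> * (S\<^sub>0 * (c * d))"
    have "0 < c'" using \<open>0 < \<beta>\<close> \<open>0 < S\<^sub>0\<close> \<open>0 < c\<close> \<open>0 < d\<close> by (simp add: c'_def)
    obtain \<delta> where "0 < \<delta>" "\<delta> \<le> 1" and \<delta>:
      "\<And>u v. c' \<le> \<bar>(a 2 - a 1) * (u - v)\<bar> \<Longrightarrow> \<bar>(a 2 - a 1) * (u - v)\<bar> \<le> pi \<Longrightarrow>
         cmod (digit_char u) \<le> 1 - \<delta> \<or> cmod (digit_char v) \<le> 1 - \<delta>"
      by (rule digit_char_small_at_one_of_two[OF \<open>0 < c'\<close>]) blast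
    define \<kappa> where "\<kappa> = 1 - min (p 1) (p 2) * \<delta>"
    have "0 < min (p 1) (p 2) * \<delta>" "min (p 1) (p 2) * \<delta> < 1 * 1"
      using first_two_weights \<open>0 < \<delta>\<close> \<open>\<delta> \<le> 1\<close> by (simp, intro mult_less_le_imp_less) auto
    then have kappa: "0 < \<kappa>" "\<kappa> < 1" by (auto simp: \<kappa>_def)
    \<comment> \<open>The induction runs over all affine images \<open>r K + b \<subseteq> K\<close>: after \<open>i\<close> digits are fixed, the
      cylinder has ratio \<open>r = \<rho>\<^sup>i\<close> and the lowest remaining frequency is \<open>S / r\<close>.\<close>
    have "(\<integral>y. (\<Prod>i<J. cmod (digit_char (S / (r * \<rho> ^ i) * G (r * y + b)))) \<partial>\<mu>) \<le> \<kappa> ^ J"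
      if S: "S\<^sub>0 \<le> \<bar>S\<bar>" "\<bar>S\<bar> \<le> S\<^sub>1" and "0 < r" and "\<And>y. y \<in> K \<Longrightarrow> r * y + b \<in> K" for S J r b
      using that(3,4)
    proof (induction J arbitrary: r b)
      case 0
      show ?case by (simp add: prob_space)
    next
      case (Suc J)
      define h where "h y = r * y + b" for y
      define M where "M y = cmod (digit_char (S / r * G (h y)))" for y
      define W where "W j y = (\<Prod>i<J. cmod (digit_char (S / (r * \<rho> * \<rho> ^ i) * G (r * \<rho> * y + (r * a j + b)))))" for j y
      have contM: "continuous_on UNIV M"
        unfolding M_def h_def by (intro continuous_intros continuous_on_compose2[OF G]) auto
      have contP: "continuous_on UNIV (W j)" for j
        unfolding W_def by (intro continuous_intros continuous_on_compose2[OF G]) auto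
      have P0: "0 \<le> W j y" for j y
        unfolding W_def by (intro prod_nonneg) auto
      have hK: "h y \<in> K" if "y \<in> K" for y
        using Suc.prems(2) that by (simp add: h_def)
      have IH: "(\<integral>y. W j y \<partial>\<mu>) \<le> \<kappa> ^ J" if j: "j \<in> {1..m}" for j
      proof -
        have "r * \<rho> * y + (r * a j + b) \<in> K" if "y \<in> K" for y
          using hK[OF map_in_K[OF that j]] by (simp add: h_def algebra_simps)
        then show ?thesis
          unfolding W_def using \<open>0 < r\<close> rho_pos by (intro Suc.IH) auto
      qed
      have split: "(\<Prod>i<Suc J. cmod (digit_char (S / (r * \<rho> ^ i) * G (h (\<rho> * y + a j))))) = M (\<rho> * y + a j) * W j y" for j y
        unfolding prod.lessThan_Suc_shift M_def W_def h_def
        by (simp add: distrib_left mult.assoc add.assoc)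
      have two: "M (\<rho> * x + a 1) \<le> 1 - \<delta> \<or> M (\<rho> * y + a 2) \<le> 1 - \<delta>" if "x \<in> K" "y \<in> K" for x y
      proof -
        define x' y' where "x' = \<rho> * x + a 1" and "y' = \<rho> * y + a 2"
        have K': "x' \<in> K" "y' \<in> K"
          using map_in_K that m_ge_2 by (auto simp: x'_def y'_def)
        define \<Delta> where "\<Delta> = \<bar>G (h x') - G (h y')\<bar>"
        have h_diff: "\<bar>h x' - h y'\<bar> = r * \<bar>x' - y'\<bar>"
          using \<open>0 < r\<close> by (simp add: h_def abs_mult flip: right_diff_distrib)
        have "c * d \<le> c * \<bar>x' - y'\<bar>"
          using d[OF that] \<open>0 < c\<close> by (simp add: x'_def y'_def)
        moreover have "c * (r * \<bar>x' - y'\<bar>) \<le> \<Delta>"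
          using lower[OF hK hK, OF K'] by (simp add: \<Delta>_def h_diff)
        moreover have "c * \<bar>x' - y'\<bar> = c * (r * \<bar>x' - y'\<bar>) / r"
          using \<open>0 < r\<close> by simp
        ultimately have lo: "c * d \<le> \<Delta> / r"
          using \<open>0 < r\<close> by (smt (verit) divide_right_mono)
        have "\<Delta> \<le> C * (r * \<bar>x' - y'\<bar>)"
          using upper[OF hK hK, OF K'] by (simp add: \<Delta>_def h_diff)
        also have "\<dots> \<le> \<bar>C\<bar> * (r * (2 * \<bar>R\<bar>))"
          using R_diff[OF K'] \<open>0 < r\<close> by (intro mult_mono mult_left_mono) auto
        finally have hi: "\<Delta> / r \<le> \<bar>C\<bar> * (2 * \<bar>R\<bar>)"
          using \<open>0 < r\<close> by (simp add: field_simps)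
        have eq: "\<bar>(a 2 - a 1) * (S / r * G (h x') - S / r * G (h y'))\<bar> = \<beta> * (\<bar>S\<bar> * (\<Delta> / r))"
          unfolding right_diff_distrib[of "S / r", symmetric]
          using \<open>0 < r\<close> by (simp add: \<beta>_def \<Delta>_def abs_mult)
        have "c' \<le> \<beta> * (\<bar>S\<bar> * (\<Delta> / r))"
          unfolding c'_def using S lo \<open>0 < \<beta>\<close> \<open>0 < S\<^sub>0\<close> \<open>0 < c\<close> \<open>0 < d\<close>
          by (intro mult_left_mono mult_mono) auto
        moreover have "\<beta> * (\<bar>S\<bar> * (\<Delta> / r)) \<le> \<beta> * (S\<^sub>1 * (\<bar>C\<bar> * (2 * \<bar>R\<bar>)))"
          using S hi \<open>0 < \<beta>\<close> \<open>0 < r\<close> \<open>0 < S\<^sub>0\<close> by (intro mult_left_mono mult_mono) (auto simp: \<Delta>_def)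
        moreover have "\<beta> * (S\<^sub>1 * (\<bar>C\<bar> * (2 * \<bar>R\<bar>))) = S\<^sub>1 * (E - 1)"
          by (simp add: E_def)
        moreover have "S\<^sub>1 * (E - 1) \<le> pi"
          using \<open>0 < E\<close> by (simp add: S\<^sub>1_def field_simps)
        ultimately have "c' \<le> \<bar>(a 2 - a 1) * (S / r * G (h x') - S / r * G (h y'))\<bar>"
          "\<bar>(a 2 - a 1) * (S / r * G (h x') - S / r * G (h y'))\<bar> \<le> pi"
          unfolding eq by linarith+
        from \<delta>[OF this] show ?thesis
          by (simp add: M_def x'_def y'_def)
      qed
      \<comment> \<open>If one point of the first piece violates the bound, then \<open>two\<close> applied to that point
        gives the bound on all of the second piece.\<close>
      have "\<exists>k\<in>{1, 2}. \<forall>y\<in>K. M (\<rho> * y + a k) \<le> 1 - \<delta>"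
        using two by blast
      then obtain k where k: "k \<in> {1, 2}" "\<And>y. y \<in> K \<Longrightarrow> M (\<rho> * y + a k) \<le> 1 - \<delta>"
        by blast
      define s where "s j = (if j = k then 1 - \<delta> else 1)" for j
      have "(\<integral>y. (\<Prod>i<Suc J. cmod (digit_char (S / (r * \<rho> ^ i) * G (h y)))) \<partial>\<mu>)
          = (\<Sum>j=1..m. p j * (\<integral>y. M (\<rho> * y + a j) * W j y \<partial>\<mu>))"
        unfolding split[symmetric]
        by (subst integral_self_similar)
          (auto intro!: integrable_continuous continuous_intros continuous_on_compose2[OF G] simp: h_def \<open>0 < r\<close>[THEN less_imp_neq, symmetric] rho_pos[THEN less_imp_neq, symmetric])
      also have "\<dots> \<le> (\<Sum>j=1..m. p j * (s j * \<kappa> ^ J))"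
      proof (rule sum_mono)
        fix j assume j: "j \<in> {1..m}"
        have "(\<integral>y. M (\<rho> * y + a j) * W j y \<partial>\<mu>) \<le> (\<integral>y. s j * W j y \<partial>\<mu>)"
        proof (rule integral_mono_K)
          show "continuous_on UNIV (\<lambda>y. M (\<rho> * y + a j) * W j y)"
            by (intro continuous_intros contP continuous_on_compose2[OF contM]) auto
          show "continuous_on UNIV (\<lambda>y. s j * W j y)"
            by (intro continuous_intros contP)
          fix y assume "y \<in> K"
          then show "M (\<rho> * y + a j) * W j y \<le> s j * W j y"
            using k(2) cmod_digit_char_le_1 by (intro mult_right_mono P0) (auto simp: s_def M_def)
        qed
        also have "\<dots> \<le> s j * \<kappa> ^ J"
          using IH[OF j] \<open>\<delta> \<le> 1\<close> by (auto simp: s_def intro!: mult_left_mono)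
        finally show "p j * (\<integral>y. M (\<rho> * y + a j) * W j y \<partial>\<mu>) \<le> p j * (s j * \<kappa> ^ J)"
          using p_nonneg[OF j] by (rule mult_left_mono)
      qed
      also have "\<dots> = (\<Sum>j=1..m. p j * s j) * \<kappa> ^ J"
        by (simp add: sum_distrib_right mult.assoc)
      also have "(\<Sum>j=1..m. p j * s j) = (\<Sum>j=1..m. p j - (if j = k then p k * \<delta> else 0))"
        by (intro sum.cong) (auto simp: s_def algebra_simps)
      also have "\<dots> = 1 - p k * \<delta>"
        using k(1) m_ge_2 sum_p by (auto simp: sum_subtractf)
      also have "(1 - p k * \<delta>) * \<kappa> ^ J \<le> \<kappa> * \<kappa> ^ J"
        using k(1) \<open>0 < \<delta>\<close> kappa by (intro mult_right_mono) (auto simp: \<kappa>_def)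
      finally show ?case by (simp add: h_def)
    qed
    from this[of _ 1 0]
    have "(\<integral>y. (\<Prod>i<J. cmod (digit_char (S / \<rho> ^ i * G y))) \<partial>\<mu>) \<le> \<kappa> ^ J"
      if "S\<^sub>0 \<le> \<bar>S\<bar>" "\<bar>S\<bar> \<le> S\<^sub>1" for S J
      using that by simp
    with kappa show "\<exists>\<kappa>>0. \<kappa> < 1 \<and> (\<forall>S J. S\<^sub>0 \<le> \<bar>S\<bar> \<longrightarrow> \<bar>S\<bar> \<le> S\<^sub>1 \<longrightarrow>
       (\<integral>y. (\<Prod>i<J. cmod (digit_char (S / \<rho> ^ i * G y))) \<partial>\<mu>) \<le> \<kappa> ^ J)"
      by blast
  qed
qed

section \<open>Linearising the phase on cylinders\<close>

text \<open>
  A bound which is affine in a second integral passes from the cylinders of generation \<open>n\<close> to the whole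
  measure, because \<open>\<mu>\<close> is a convex combination of its cylinders. Cylinders enter only through
  their invariance \<open>\<rho>\<^sup>n K + b \<subseteq> K\<close>, which avoids indexing them by words.
\<close>

lemma cmod_integral_le_by_cylinders:
  fixes F :: "real \<Rightarrow> complex" and H :: "real \<Rightarrow> real"
  assumes F: "continuous_on UNIV F" and H: "continuous_on UNIV H"
    and cyl: "\<And>b. (\<And>y. y \<in> K \<Longrightarrow> \<rho> ^ n * y + b \<in> K) \<Longrightarrow>
      cmod (\<integral>y. F (\<rho> ^ n * y + b) \<partial>\<mu>) \<le> (\<integral>y. H (\<rho> ^ n * y + b) \<partial>\<mu>) + e"
  shows "cmod (\<integral>y. F y \<partial>\<mu>) \<le> (\<integral>y. H y \<partial>\<mu>) + e"
  using cyl
proof (induction n)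
  case 0
  show ?case using "0.prems"[of 0] by simp
next
  case (Suc n)
  show ?case
  proof (rule Suc.IH)
    fix b assume b: "\<And>y. y \<in> K \<Longrightarrow> \<rho> ^ n * y + b \<in> K"
    have eq: "\<rho> ^ n * (\<rho> * y + a j) + b = \<rho> ^ Suc n * y + (\<rho> ^ n * a j + b)" for j y
      by (simp add: algebra_simps)
    have "(\<integral>y. F (\<rho> ^ n * y + b) \<partial>\<mu>) = (\<Sum>j=1..m. p j *\<^sub>R (\<integral>y. F (\<rho> ^ Suc n * y + (\<rho> ^ n * a j + b)) \<partial>\<mu>))"
      unfolding eq[symmetric]
      by (intro integral_self_similar integrable_continuous continuous_on_compose2[OF F] continuous_intros) auto
    then have "cmod (\<integral>y. F (\<rho> ^ n * y + b) \<partial>\<mu>)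
        \<le> (\<Sum>j=1..m. cmod (p j *\<^sub>R (\<integral>y. F (\<rho> ^ Suc n * y + (\<rho> ^ n * a j + b)) \<partial>\<mu>)))"
      by (simp only: norm_sum)
    also have "\<dots> \<le> (\<Sum>j=1..m. p j * ((\<integral>y. H (\<rho> ^ Suc n * y + (\<rho> ^ n * a j + b)) \<partial>\<mu>) + e))"
    proof (rule sum_mono)
      fix j assume j: "j \<in> {1..m}"
      have "cmod (\<integral>y. F (\<rho> ^ Suc n * y + (\<rho> ^ n * a j + b)) \<partial>\<mu>)
          \<le> (\<integral>y. H (\<rho> ^ Suc n * y + (\<rho> ^ n * a j + b)) \<partial>\<mu>) + e"
        using b[OF map_in_K[OF _ j]] by (intro Suc.prems) (simp only: eq)
      then show "cmod (p j *\<^sub>R (\<integral>y. F (\<rho> ^ Suc n * y + (\<rho> ^ n * a j + b)) \<partial>\<mu>))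
          \<le> p j * ((\<integral>y. H (\<rho> ^ Suc n * y + (\<rho> ^ n * a j + b)) \<partial>\<mu>) + e)"
        using p_nonneg[OF j] by (simp only: norm_scaleR abs_of_nonneg mult_left_mono)
    qed
    also have "\<dots> = (\<Sum>j=1..m. p j *\<^sub>R (\<integral>y. H (\<rho> ^ Suc n * y + (\<rho> ^ n * a j + b)) \<partial>\<mu>)) + (\<Sum>j=1..m. p j) * e"
      by (simp add: distrib_left sum.distrib sum_distrib_right)
    also have "(\<Sum>j=1..m. p j *\<^sub>R (\<integral>y. H (\<rho> ^ Suc n * y + (\<rho> ^ n * a j + b)) \<partial>\<mu>)) = (\<integral>y. H (\<rho> ^ n * y + b) \<partial>\<mu>)"
      unfolding eq[symmetric]
      by (intro integral_self_similar[symmetric] integrable_continuous continuous_on_compose2[OF H] continuous_intros) auto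
    finally show "cmod (\<integral>y. F (\<rho> ^ n * y + b) \<partial>\<mu>) \<le> (\<integral>y. H (\<rho> ^ n * y + b) \<partial>\<mu>) + e"
      using sum_p by simp
  qed
qed

text \<open>
  On a cylinder \<open>h K\<close>, with \<open>h x = \<rho>\<^sup>n x + b\<close>, the tangent of \<open>\<phi>\<close> at any of its points \<open>h y\<close> turns
  the integral into the characteristic function of \<open>\<mu>\<close> at \<open>\<rho>\<^sup>n \<tau> G (h y)\<close>, where \<open>G\<close> stands for \<open>\<phi>'\<close>.
  The left-hand side does not depend on \<open>y\<close>, so the estimate may be averaged over \<open>y\<close>; this is what
  turns the sum over cylinders into an integral with respect to \<open>\<mu>\<close> itself.
\<close>

lemma oscillatory_integral_le_mean_digit_char_product:
  fixes \<phi> G :: "real \<Rightarrow> real" and g :: "real \<Rightarrow> complex"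
  assumes cont: "continuous_on UNIV \<phi>" "continuous_on UNIV G" "continuous_on UNIV g"
    and taylor: "\<And>x y. x \<in> K \<Longrightarrow> y \<in> K \<Longrightarrow> \<bar>\<phi> x - \<phi> y - G y * (x - y)\<bar> \<le> C * \<bar>x - y\<bar>\<^sup>2" and "0 \<le> C"
    and bound: "\<And>x. x \<in> K \<Longrightarrow> cmod (g x) \<le> B"
    and lipschitz: "\<And>x y. x \<in> K \<Longrightarrow> y \<in> K \<Longrightarrow> cmod (g x - g y) \<le> L * \<bar>x - y\<bar>" and "0 \<le> L"
    and diam: "\<And>x y. x \<in> K \<Longrightarrow> y \<in> K \<Longrightarrow> \<bar>x - y\<bar> \<le> D"
  shows "cmod (\<integral>x. cis (\<tau> * \<phi> x) * g x \<partial>\<mu>)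
    \<le> B * (\<integral>y. (\<Prod>i<J. cmod (digit_char (\<rho> ^ i * (\<rho> ^ n * \<tau> * G y)))) \<partial>\<mu>)
      + (B * (\<bar>\<tau>\<bar> * (C * (\<rho> ^ n * D)\<^sup>2)) + L * (\<rho> ^ n * D))"
proof -
  define r where "r = \<rho> ^ n"
  define e where "e = B * (\<bar>\<tau>\<bar> * (C * (r * D)\<^sup>2)) + L * (r * D)"
  define F where "F x = cis (\<tau> * \<phi> x) * g x" for x
  define W where "W y = (\<Prod>i<J. cmod (digit_char (\<rho> ^ i * (r * \<tau> * G y))))" for y
  have "0 < r" using rho_pos by (simp add: r_def)
  have contF: "continuous_on UNIV F" and contW: "continuous_on UNIV W"
    unfolding F_def W_def by (intro continuous_intros cont)+
  have "0 \<le> B"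
    using bound K_nonempty by (meson all_not_in_conv norm_ge_zero order_trans)
  have "cmod (\<integral>y. F y \<partial>\<mu>) \<le> (\<integral>y. B * W y \<partial>\<mu>) + e"
  proof (rule cmod_integral_le_by_cylinders[where n = n, folded r_def])
    show "continuous_on UNIV (\<lambda>y. B * W y)"
      by (intro continuous_intros contW)
    fix b assume inv: "\<And>y. y \<in> K \<Longrightarrow> r * y + b \<in> K"
    define h where "h y = r * y + b" for y
    have h: "h y \<in> K" if "y \<in> K" for y using inv that by (simp add: h_def)
    have conth: "continuous_on UNIV h" unfolding h_def by (intro continuous_intros)
    have loc: "cmod (\<integral>x. F (h x) \<partial>\<mu>) \<le> B * W (h y) + e" if y: "y \<in> K" for y
    proof -
      \<comment> \<open>\<open>A\<close> is the integrand with \<open>\<phi>\<close> replaced by its tangent and \<open>g\<close> frozen, both at \<open>h y\<close>.\<close>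
      define A where "A x = cis (\<tau> * (\<phi> (h y) + G (h y) * (h x - h y))) * g (h y)" for x
      have contA: "continuous_on UNIV A"
        unfolding A_def by (intro continuous_intros conth)
      have contFh: "continuous_on UNIV (\<lambda>x. F (h x))"
        by (rule continuous_on_compose2[OF contF conth]) simp
      have diff: "cmod (F (h x) - A x) \<le> e" if x: "x \<in> K" for x
      proof -
        define s t where "s = \<tau> * \<phi> (h x)" and "t = \<tau> * (\<phi> (h y) + G (h y) * (h x - h y))"
        have "\<bar>h x - h y\<bar> = r * \<bar>x - y\<bar>"
          using \<open>0 < r\<close> by (simp add: h_def abs_mult flip: right_diff_distrib)
        also have "\<dots> \<le> r * D"
          using diam[OF x y] \<open>0 < r\<close> by (intro mult_left_mono) auto
        finally have hD: "\<bar>h x - h y\<bar> \<le> r * D" .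
        have "F (h x) - A x = cis s * (g (h x) - g (h y)) + (cis s - cis t) * g (h y)"
          by (simp add: F_def A_def s_def t_def algebra_simps)
        then have "cmod (F (h x) - A x) \<le> cmod (g (h x) - g (h y)) + cmod (cis s - cis t) * cmod (g (h y))"
          using norm_triangle_ineq[of "cis s * (g (h x) - g (h y))" "(cis s - cis t) * g (h y)"]
          by (simp add: norm_mult)
        also have "cmod (g (h x) - g (h y)) \<le> L * (r * D)"
          using lipschitz[OF h[OF x] h[OF y]] mult_left_mono[OF hD \<open>0 \<le> L\<close>] by linarith
        also have "cmod (cis s - cis t) * cmod (g (h y)) \<le> (\<bar>\<tau>\<bar> * (C * (r * D)\<^sup>2)) * B"
        proof (rule mult_mono)
          have "s - t = \<tau> * (\<phi> (h x) - \<phi> (h y) - G (h y) * (h x - h y))"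
            by (simp add: s_def t_def algebra_simps)
          then have "\<bar>s - t\<bar> = \<bar>\<tau>\<bar> * \<bar>\<phi> (h x) - \<phi> (h y) - G (h y) * (h x - h y)\<bar>"
            by (simp only: abs_mult)
          also have "\<dots> \<le> \<bar>\<tau>\<bar> * (C * \<bar>h x - h y\<bar>\<^sup>2)"
            using taylor[OF h[OF x] h[OF y]] by (intro mult_left_mono) auto
          also have "\<dots> \<le> \<bar>\<tau>\<bar> * (C * (r * D)\<^sup>2)"
            using hD \<open>0 \<le> C\<close> by (intro mult_left_mono power_mono) auto
          finally show "cmod (cis s - cis t) \<le> \<bar>\<tau>\<bar> * (C * (r * D)\<^sup>2)"
            using cmod_cis_diff_le[of s t] by linarith
        qed (use bound[OF h[OF y]] \<open>0 \<le> C\<close> in auto)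
        finally show ?thesis by (simp add: e_def mult.commute)
      qed
      have "A x = (cis (\<tau> * (\<phi> (h y) - G (h y) * (r * y))) * g (h y)) * iexp ((r * \<tau> * G (h y)) * x)" for x
        by (simp add: A_def h_def cis_conv_exp exp_add[symmetric] algebra_simps)
      then have "(\<integral>x. A x \<partial>\<mu>) = (cis (\<tau> * (\<phi> (h y) - G (h y) * (r * y))) * g (h y)) * char \<mu> (r * \<tau> * G (h y))"
        by (simp only: char_def integral_mult_right_zero)
      then have "cmod (\<integral>x. A x \<partial>\<mu>) = cmod (g (h y)) * cmod (char \<mu> (r * \<tau> * G (h y)))"
        by (simp add: norm_mult)
      also have "\<dots> \<le> B * W (h y)"
        unfolding W_def using \<open>0 \<le> B\<close> bound[OF h[OF y]] by (intro mult_mono cmod_char_le_digit_char_product) auto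
      finally have main: "cmod (\<integral>x. A x \<partial>\<mu>) \<le> B * W (h y)" .
      have "(\<integral>x. F (h x) \<partial>\<mu>) = (\<integral>x. A x \<partial>\<mu>) + (\<integral>x. F (h x) - A x \<partial>\<mu>)"
        using integrable_continuous[OF contA] integrable_continuous[OF contFh] by simp
      then have "cmod (\<integral>x. F (h x) \<partial>\<mu>) \<le> cmod (\<integral>x. A x \<partial>\<mu>) + cmod (\<integral>x. F (h x) - A x \<partial>\<mu>)"
        by (simp only: norm_triangle_ineq)
      also have "cmod (\<integral>x. F (h x) - A x \<partial>\<mu>) \<le> (\<integral>x. cmod (F (h x) - A x) \<partial>\<mu>)"
        by (rule integral_norm_bound)
      also have "\<dots> \<le> (\<integral>x. e \<partial>\<mu>)"
        by (intro integral_mono_K diff continuous_intros contFh contA)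
      finally show ?thesis using main by simp
    qed
    have contWh: "continuous_on UNIV (\<lambda>y. W (h y))"
      by (rule continuous_on_compose2[OF contW conth]) simp
    have "cmod (\<integral>x. F (h x) \<partial>\<mu>) = (\<integral>y. cmod (\<integral>x. F (h x) \<partial>\<mu>) \<partial>\<mu>)"
      by simp
    also have "\<dots> \<le> (\<integral>y. B * W (h y) + e \<partial>\<mu>)"
      by (intro integral_mono_K loc continuous_intros contWh)
    also have "\<dots> = (\<integral>y. B * W (h y) \<partial>\<mu>) + e"
      using integrable_continuous[OF contWh] by simp
    finally show "cmod (\<integral>y. F (r * y + b) \<partial>\<mu>) \<le> (\<integral>y. B * W (r * y + b) \<partial>\<mu>) + e"
      by (simp add: h_def)
  qed (fact contF)
  then show ?thesis
    by (simp add: F_def W_def e_def r_def)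
qed

section \<open>Power decay\<close>

text \<open>
  The two scales compete: the linearisation needs \<open>|\<tau>| \<rho>\<^bsup>2n\<^esup>\<close> small, whereas the averaged product needs
  \<open>|\<tau>| \<rho>\<^sup>n\<close> large. Any \<open>n\<close> with \<open>\<rho>\<^sup>n = |\<tau>|\<^bsup>-\<alpha>\<^esup>\<close> and \<open>1/2 < \<alpha> < 1\<close> would do; here \<open>\<alpha>\<close> is essentially
  \<open>2/3\<close>.
\<close>

theorem oscillatory_integral_power_decay:
  fixes \<phi> G G' :: "real \<Rightarrow> real" and g :: "real \<Rightarrow> complex"
  assumes phi: "\<And>x. (\<phi> has_real_derivative G x) (at x)"
    and G: "\<And>x. (G has_real_derivative G' x) (at x)"
    and contG': "continuous_on UNIV G'" and pos: "\<And>x. 0 < G' x"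
    and g: "g C1_differentiable_on UNIV"
  obtains \<gamma> A T where "0 < \<gamma>"
    "\<And>\<tau>. T \<le> \<bar>\<tau>\<bar> \<Longrightarrow> cmod (\<integral>x. cis (\<tau> * \<phi> x) * g x \<partial>\<mu>) \<le> A * \<bar>\<tau>\<bar> powr (- \<gamma>)"
proof -
  obtain R where R0: "\<And>x. x \<in> K \<Longrightarrow> \<bar>x\<bar> \<le> R"
    using compact_imp_bounded[OF compact_K] by (auto simp: bounded_iff)
  \<comment> \<open>Derivative bounds are taken on an interval around \<open>K\<close>, since the mean value theorem leaves \<open>K\<close>.\<close>
  define I where "I = {-R..R}"
  have KI: "x \<in> I" if "x \<in> K" for x
    using R0[OF that] by (auto simp: I_def)
  have I: "compact I" "convex I"
    by (simp_all add: I_def)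
  have "I \<noteq> {}" using KI K_nonempty by blast
  have contG: "continuous_on UNIV G" and contphi: "continuous_on UNIV \<phi>"
    using G phi by (auto intro!: DERIV_isCont continuous_at_imp_continuous_on)
  have contG'I: "continuous_on I G'"
    using contG' by (rule continuous_on_subset) simp
  obtain c where c: "0 < c" "\<And>x. x \<in> I \<Longrightarrow> c \<le> G' x"
    using continuous_attains_inf[OF I(1) \<open>I \<noteq> {}\<close> contG'I] pos by blast
  obtain C where C: "0 < C" "\<And>x. x \<in> I \<Longrightarrow> G' x \<le> C"
    using continuous_attains_sup[OF I(1) \<open>I \<noteq> {}\<close> contG'I] pos by blast
  have mvt: "\<exists>z\<in>I. \<bar>z - y\<bar> \<le> \<bar>x - y\<bar> \<and> f x - f y = (x - y) * f' z"
    if f: "\<And>x. (f has_real_derivative f' x) (at x)" and xy: "x \<in> I" "y \<in> I" for f f' :: "real \<Rightarrow> real" and x y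
  proof (cases x y rule: linorder_cases)
    case less
    then obtain z where "x < z" "z < y" "f y - f x = (y - x) * f' z"
      using MVT2[of x y f f'] f by blast
    then show ?thesis using xy by (intro bexI[of _ z]) (auto simp: I_def algebra_simps)
  next
    case equal
    then show ?thesis using xy by auto
  next
    case greater
    then obtain z where "y < z" "z < x" "f x - f y = (x - y) * f' z"
      using MVT2[of y x f f'] f by blast
    then show ?thesis using xy by (intro bexI[of _ z]) (auto simp: I_def)
  qed
  have lower: "c * \<bar>x - y\<bar> \<le> \<bar>G x - G y\<bar>" and upper: "\<bar>G x - G y\<bar> \<le> C * \<bar>x - y\<bar>"
    if xy: "x \<in> I" "y \<in> I" for x y
  proof -
    obtain z where z: "z \<in> I" "G x - G y = (x - y) * G' z"
      using mvt[OF G xy] by blast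
    have "\<bar>G x - G y\<bar> = G' z * \<bar>x - y\<bar>"
      using pos[of z] by (simp add: z abs_mult)
    then show "c * \<bar>x - y\<bar> \<le> \<bar>G x - G y\<bar>" "\<bar>G x - G y\<bar> \<le> C * \<bar>x - y\<bar>"
      using c(2)[OF z(1)] C(2)[OF z(1)] by (auto intro: mult_right_mono)
  qed
  have taylor: "\<bar>\<phi> x - \<phi> y - G y * (x - y)\<bar> \<le> C * \<bar>x - y\<bar>\<^sup>2" if xy: "x \<in> I" "y \<in> I" for x y
  proof -
    obtain z where z: "z \<in> I" "\<bar>z - y\<bar> \<le> \<bar>x - y\<bar>" "\<phi> x - \<phi> y = (x - y) * G z"
      using mvt[OF phi xy] by blast
    have "\<bar>\<phi> x - \<phi> y - G y * (x - y)\<bar> = \<bar>G z - G y\<bar> * \<bar>x - y\<bar>"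
      by (simp add: z(3) mult.commute flip: abs_mult left_diff_distrib right_diff_distrib)
    also have "\<dots> \<le> (C * \<bar>x - y\<bar>) * \<bar>x - y\<bar>"
      using upper[OF z(1) xy(2)] mult_left_mono[OF z(2) less_imp_le[OF C(1)]]
      by (intro mult_right_mono) linarith+
    finally show ?thesis by (simp add: power2_eq_square mult.assoc)
  qed
  obtain g' where g': "\<And>x. (g has_vector_derivative g' x) (at x)" and contg': "continuous_on UNIV g'"
    using g by (auto simp: C1_differentiable_on_def)
  have contg: "continuous_on UNIV g"
    using g' by (auto intro!: has_vector_derivative_continuous continuous_at_imp_continuous_on)
  have bounded_image: "\<exists>B\<ge>0. \<forall>x\<in>I. cmod (f x) \<le> B" if "continuous_on UNIV f" for f :: "real \<Rightarrow> complex"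
  proof -
    have "compact (f ` I)"
      using continuous_on_subset[OF that] I(1) by (intro compact_continuous_image) auto
    then have "bounded (f ` I)" by (rule compact_imp_bounded)
    then show ?thesis unfolding bounded_pos by (auto intro: less_imp_le)
  qed
  obtain B where B: "0 \<le> B" "\<And>x. x \<in> I \<Longrightarrow> cmod (g x) \<le> B"
    using bounded_image[OF contg] by blast
  obtain L where L: "0 \<le> L" "\<And>x. x \<in> I \<Longrightarrow> cmod (g' x) \<le> L"
    using bounded_image[OF contg'] by blast
  have lipschitz: "cmod (g x - g y) \<le> L * \<bar>x - y\<bar>" if "x \<in> I" "y \<in> I" for x y
  proof -
    have "norm (g x - g y) \<le> L * norm (x - y)"
    proof (rule differentiable_bound[OF I(2)])
      fix x assume "x \<in> I"
      show "(g has_derivative (\<lambda>h. h *\<^sub>R g' x)) (at x within I)"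
        using g'[of x] by (auto simp: has_vector_derivative_def intro: has_derivative_at_withinI)
      show "onorm (\<lambda>h. h *\<^sub>R g' x) \<le> L"
        using L(2)[OF \<open>x \<in> I\<close>] by (intro onorm_le) (simp add: mult.commute[of L] mult_left_mono)
    qed fact+
    then show ?thesis by simp
  qed
  define D where "D = 2 * \<bar>R\<bar>"
  have D: "\<bar>x - y\<bar> \<le> D" if "x \<in> I" "y \<in> I" for x y
    using that unfolding I_def D_def by auto
  obtain S\<^sub>1 where S1: "0 < S\<^sub>1" and decay:
    "\<And>S\<^sub>0. 0 < S\<^sub>0 \<Longrightarrow> \<exists>\<kappa>>0. \<kappa> < 1 \<and> (\<forall>S J. S\<^sub>0 \<le> \<bar>S\<bar> \<longrightarrow> \<bar>S\<bar> \<le> S\<^sub>1 \<longrightarrow>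
       (\<integral>y. (\<Prod>i<J. cmod (digit_char (S / \<rho> ^ i * G y))) \<partial>\<mu>) \<le> \<kappa> ^ J)"
    using mean_digit_char_product_decay[OF contG c(1) lower upper] KI by blast
  have q: "0 < \<rho> ^ 3" "\<rho> ^ 3 < 1"
    using rho_pos rho_less_1 by (auto simp: power_less_one_iff)
  obtain \<kappa> where kappa: "0 < \<kappa>" "\<kappa> < 1" and mean:
    "\<And>S J. \<rho> ^ 3 * S\<^sub>1 \<le> \<bar>S\<bar> \<Longrightarrow> \<bar>S\<bar> \<le> S\<^sub>1 \<Longrightarrow> (\<integral>y. (\<Prod>i<J. cmod (digit_char (S / \<rho> ^ i * G y))) \<partial>\<mu>) \<le> \<kappa> ^ J"
    using decay[of "\<rho> ^ 3 * S\<^sub>1"] q S1 by auto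
  define \<theta> where "\<theta> = max \<kappa> \<rho>"
  have lambda: "0 < \<theta>" "\<theta> < 1" "\<kappa> \<le> \<theta>" "\<rho> \<le> \<theta>"
    using kappa rho_pos rho_less_1 by (auto simp: \<theta>_def)
  \<comment> \<open>The exponent is the one for which \<open>(\<rho>\<^sup>3)\<^bsup>\<gamma>\<^esup> = \<theta>\<close>.\<close>
  define \<gamma> where "\<gamma> = ln \<theta> / ln (\<rho> ^ 3)"
  have "0 < \<gamma>"
    unfolding \<gamma>_def using q lambda by (intro divide_neg_neg) (auto simp: ln_less_zero)
  have powr: "\<theta> ^ k = ((\<rho> ^ 3) ^ k) powr \<gamma>" for k
  proof -
    have "ln (\<rho> ^ 3) \<noteq> 0" using ln_less_zero[OF q] by simp
    then have "(\<rho> ^ 3) powr \<gamma> = \<theta>"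
      using q lambda by (simp add: powr_def \<gamma>_def)
    then show ?thesis
      using q by (metis powr_realpow powr_powr powr_powr_swap zero_less_power less_imp_le lambda(1))
  qed
  define A where "A = B + B * (S\<^sub>1 * (C * D\<^sup>2)) + L * D"
  have "0 \<le> D" by (simp add: D_def)
  have "0 \<le> A" using B C L S1 \<open>0 \<le> D\<close> by (simp add: A_def)
  have "cmod (\<integral>x. cis (\<tau> * \<phi> x) * g x \<partial>\<mu>) \<le> (A * S\<^sub>1 powr \<gamma>) * \<bar>\<tau>\<bar> powr (- \<gamma>)" if tau: "S\<^sub>1 \<le> \<bar>\<tau>\<bar>" for \<tau>
  proof -
    obtain k where k: "\<rho> ^ 3 * S\<^sub>1 \<le> (\<rho> ^ 3) ^ k * \<bar>\<tau>\<bar>" "(\<rho> ^ 3) ^ k * \<bar>\<tau>\<bar> \<le> S\<^sub>1"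
      using geometric_rescaling[OF q S1 tau] by blast
    define S where "S = (\<rho> ^ 3) ^ k * \<tau>"
    have S: "\<rho> ^ 3 * S\<^sub>1 \<le> \<bar>S\<bar>" "\<bar>S\<bar> \<le> S\<^sub>1"
      using k q by (simp_all add: S_def abs_mult)
    \<comment> \<open>The lowest frequency in the product is \<open>\<rho>\<^sup>k \<rho>\<^bsup>2k\<^esup> \<tau> = S\<close>; reversing the order starts from it.\<close>
    have reindex: "(\<Prod>i<Suc k. cmod (digit_char (\<rho> ^ i * (\<rho> ^ (2 * k) * \<tau> * G y))))
        = (\<Prod>i<Suc k. cmod (digit_char (S / \<rho> ^ i * G y)))" for y
    proof -
      have "\<rho> ^ i * (\<rho> ^ (2 * k) * \<tau> * G y) = S / \<rho> ^ (k - i) * G y" if "i < Suc k" for i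
      proof -
        have "(\<rho> ^ 3) ^ k = \<rho> ^ i * \<rho> ^ (2 * k) * \<rho> ^ (k - i)"
          using that by (simp flip: power_mult power_add)
        then show ?thesis using rho_pos by (simp add: S_def)
      qed
      then have "(\<Prod>i<Suc k. cmod (digit_char (\<rho> ^ i * (\<rho> ^ (2 * k) * \<tau> * G y))))
          = (\<Prod>i<Suc k. cmod (digit_char (S / \<rho> ^ (Suc k - Suc i) * G y)))"
        by (intro prod.cong) auto
      then show ?thesis
        unfolding prod.nat_diff_reindex[of "\<lambda>i. cmod (digit_char (S / \<rho> ^ i * G y))" "Suc k"] .
    qed
    have "cmod (\<integral>x. cis (\<tau> * \<phi> x) * g x \<partial>\<mu>)
      \<le> B * (\<integral>y. (\<Prod>i<Suc k. cmod (digit_char (\<rho> ^ i * (\<rho> ^ (2 * k) * \<tau> * G y)))) \<partial>\<mu>)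
      + (B * (\<bar>\<tau>\<bar> * (C * (\<rho> ^ (2 * k) * D)\<^sup>2)) + L * (\<rho> ^ (2 * k) * D))"
      using taylor B(2) lipschitz D KI C(1) L(1)
      by (intro oscillatory_integral_le_mean_digit_char_product contphi contG contg) auto
    also have "\<dots> \<le> B * \<theta> ^ k + (B * (S\<^sub>1 * (C * D\<^sup>2)) * \<theta> ^ k + L * D * \<theta> ^ k)"
    proof (intro add_mono)
      have "(\<integral>y. (\<Prod>i<Suc k. cmod (digit_char (\<rho> ^ i * (\<rho> ^ (2 * k) * \<tau> * G y)))) \<partial>\<mu>) \<le> \<kappa> ^ Suc k"
        unfolding reindex by (rule mean[OF S])
      also have "\<dots> \<le> 1 * \<kappa> ^ k"
        unfolding power_Suc using kappa by (intro mult_right_mono) auto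
      also have "\<dots> \<le> \<theta> ^ k"
        using kappa lambda by (simp add: power_mono)
      finally show "B * (\<integral>y. (\<Prod>i<Suc k. cmod (digit_char (\<rho> ^ i * (\<rho> ^ (2 * k) * \<tau> * G y)))) \<partial>\<mu>) \<le> B * \<theta> ^ k"
        using B(1) by (rule mult_left_mono)
      have rk: "\<rho> ^ k \<le> \<theta> ^ k"
        using rho_pos lambda by (intro power_mono) auto
      have "\<bar>\<tau>\<bar> * (C * (\<rho> ^ (2 * k) * D)\<^sup>2) = (\<bar>\<tau>\<bar> * (\<rho> ^ 3) ^ k) * (C * D\<^sup>2) * \<rho> ^ k"
        by (simp add: power_mult_distrib flip: power_mult power_add)
      also have "\<dots> \<le> S\<^sub>1 * (C * D\<^sup>2) * \<theta> ^ k"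
        using k(2) rk C(1) S1 rho_pos by (intro mult_mono) (auto simp: mult.commute)
      finally show "B * (\<bar>\<tau>\<bar> * (C * (\<rho> ^ (2 * k) * D)\<^sup>2)) \<le> B * (S\<^sub>1 * (C * D\<^sup>2)) * \<theta> ^ k"
        using mult_left_mono[OF _ B(1)] by (simp add: mult.assoc)
      have "\<rho> ^ (2 * k) \<le> \<rho> ^ k"
        using rho_pos rho_less_1 by (intro power_decreasing) auto
      with rk have "\<rho> ^ (2 * k) \<le> \<theta> ^ k" by simp
      then show "L * (\<rho> ^ (2 * k) * D) \<le> L * D * \<theta> ^ k"
        using L(1) \<open>0 \<le> D\<close> by (simp add: mult.assoc mult.commute[of D] mult_left_mono mult_right_mono)
    qed
    also have "\<dots> = A * \<theta> ^ k"
      by (simp add: A_def algebra_simps)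
    also have "\<theta> ^ k \<le> (S\<^sub>1 / \<bar>\<tau>\<bar>) powr \<gamma>"
      unfolding powr using k(2) tau S1 \<open>0 < \<gamma>\<close> q by (intro powr_mono2) (auto simp: field_simps)
    also have "\<dots> = S\<^sub>1 powr \<gamma> * \<bar>\<tau>\<bar> powr (- \<gamma>)"
      using S1 tau by (simp add: powr_divide powr_minus_divide)
    finally show ?thesis
      using \<open>0 \<le> A\<close> by (simp add: mult.assoc mult_left_mono)
  qed
  with \<open>0 < \<gamma>\<close> show ?thesis by (rule that)
qed

end

theorem theorem1p1:
  fixes m :: nat and \<rho> :: real and a p :: "nat \<Rightarrow> real"
    and K :: "real set" and \<mu> :: "real measure" and \<phi> :: "real \<Rightarrow> real"
  assumes "m \<ge> 2" and "0 < \<rho>" and "\<rho> < 1"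
    and "is_attractor m (homogeneous_ifs \<rho> a) K"
    and "strong_separation m (homogeneous_ifs \<rho> a) K"
    and "positive_probability_vector m p"
    and "is_self_similar_measure m (homogeneous_ifs \<rho> a) p K \<mu>"
    and "\<forall>t. \<phi> differentiable (at t)"
    and "deriv \<phi> C1_differentiable_on UNIV"
    and "\<forall>t. deriv (deriv \<phi>) t > 0"
  shows "(\<forall>g :: real \<Rightarrow> complex. g C1_differentiable_on UNIV \<longrightarrow>
            (\<exists>\<gamma>>0. (\<lambda>\<xi>. cmod (\<integral>t. exp (2 * of_real pi * \<i> * of_real \<xi> * of_real (\<phi> t)) * g t \<partial>\<mu>))
                     \<in> O[at_infinity](\<lambda>\<xi>. \<bar>\<xi>\<bar> powr (- \<gamma>)))) \<and>
         (\<exists>\<gamma>>0. (\<lambda>\<xi>. cmod (fourier_transform (distr \<mu> borel \<phi>) \<xi>))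
                  \<in> O[at_infinity](\<lambda>\<xi>. \<bar>\<xi>\<bar> powr (- \<gamma>)))"
proof -
  interpret homogeneous_self_similar_measure m \<rho> a p K \<mu>
    using assms(1-7) by unfold_locales
  have phi: "(\<phi> has_real_derivative deriv \<phi> t) (at t)" for t
    using assms(8) by (simp add: DERIV_deriv_iff_real_differentiable)
  obtain D where D: "\<And>t. (deriv \<phi> has_vector_derivative D t) (at t)" and contD: "continuous_on UNIV D"
    using assms(9) by (auto simp: C1_differentiable_on_def)
  have phi': "(deriv \<phi> has_real_derivative D t) (at t)" for t
    using D by (simp add: has_real_derivative_iff_has_vector_derivative)
  have pos: "0 < D t" for t
    using assms(10) DERIV_imp_deriv[OF phi'] by metis
  have decay: "\<exists>\<gamma>>0. (\<lambda>\<xi>. cmod (\<integral>t. exp (2 * of_real pi * \<i> * of_real \<xi> * of_real (\<phi> t)) * g t \<partial>\<mu>))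
      \<in> O[at_infinity](\<lambda>\<xi>. \<bar>\<xi>\<bar> powr (- \<gamma>))" if g: "g C1_differentiable_on UNIV" for g :: "real \<Rightarrow> complex"
  proof -
    obtain \<gamma> A T where "0 < \<gamma>" and bound:
      "\<And>\<tau>. T \<le> \<bar>\<tau>\<bar> \<Longrightarrow> cmod (\<integral>x. cis (\<tau> * \<phi> x) * g x \<partial>\<mu>) \<le> A * \<bar>\<tau>\<bar> powr (- \<gamma>)"
      by (rule oscillatory_integral_power_decay[OF phi phi' contD pos g]) blast
    have "(\<lambda>\<xi>. cmod (\<integral>t. exp (2 * of_real pi * \<i> * of_real \<xi> * of_real (\<phi> t)) * g t \<partial>\<mu>))
      \<in> O[at_infinity](\<lambda>\<xi>. \<bar>\<xi>\<bar> powr (- \<gamma>))"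
    proof (rule bigoI[where c = "A * (2 * pi) powr (- \<gamma>)"], unfold eventually_at_infinity, intro exI allI impI)
      fix \<xi> :: real assume "\<bar>T\<bar> \<le> norm \<xi>"
      moreover have "1 * \<bar>\<xi>\<bar> \<le> (2 * pi) * \<bar>\<xi>\<bar>"
        using pi_ge_two by (intro mult_right_mono) auto
      ultimately have "T \<le> \<bar>2 * pi * \<xi>\<bar>" by (simp add: abs_mult)
      moreover have "exp (2 * of_real pi * \<i> * of_real \<xi> * of_real (\<phi> t)) = cis (2 * pi * \<xi> * \<phi> t)" for t
        by (simp add: cis_conv_exp mult_ac)
      ultimately show "norm (cmod (\<integral>t. exp (2 * of_real pi * \<i> * of_real \<xi> * of_real (\<phi> t)) * g t \<partial>\<mu>))
          \<le> A * (2 * pi) powr (- \<gamma>) * norm (\<bar>\<xi>\<bar> powr (- \<gamma>))"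
        using bound[of "2 * pi * \<xi>"] by (simp add: abs_mult powr_mult mult.assoc)
    qed
    with \<open>0 < \<gamma>\<close> show ?thesis by blast
  qed
  have "continuous_on UNIV \<phi>"
    using phi by (auto intro!: DERIV_isCont continuous_at_imp_continuous_on)
  then have [measurable]: "\<phi> \<in> borel_measurable \<mu>"
    by (rule measurable_continuous)
  have "fourier_transform (distr \<mu> borel \<phi>) \<xi>
      = (\<integral>t. exp (2 * of_real pi * \<i> * of_real \<xi> * of_real (\<phi> t)) * 1 \<partial>\<mu>)" for \<xi>
    unfolding fourier_transform_def by (subst integral_distr) auto
  with decay[of "\<lambda>_. 1"]
  have "\<exists>\<gamma>>0. (\<lambda>\<xi>. cmod (fourier_transform (distr \<mu> borel \<phi>) \<xi>))
      \<in> O[at_infinity](\<lambda>\<xi>. \<bar>\<xi>\<bar> powr (- \<gamma>))"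
    by (simp only: C1_differentiable_on_const)
  with decay show ?thesis by blast
qed

end
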